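(* Let $f\in L^2(\Omega)$ and $\varepsilon>0$. Let $\tilde u\in H_0^2(\Omega)$ be the solution of $$\varepsilon^2(\triangle\tilde u,\triangle v)+(\nabla\tilde u,\nabla v)=(f,v)\qquad\forall\, v\in H_0^2(\Omega),$$ and let $(\psi,u)\in H^1(\Omega)\times H_0^1(\Omega)$ be the solution of the mixed problem $$\varepsilon^2(\nabla\psi,\nabla\varphi)+(\psi,\varphi)=(f,\varphi)\quad\forall\,\varphi\in H_0^1(\Omega),\qquad (\nabla u,\nabla v)=(\psi,v)\quad\forall\, v\in H^1(\Omega).$$ Then $\tilde u$ and $u$ are identical if and only if $u\in H_0^2(\Omega)$.
   Context: $\Omega\subset\mathbb{R}^d$, $d\in\{2,3\}$, is a bounded polygonal ($d=2$) or polyhedral ($d=3$) domain with Lipschitz boundary. $(\cdot,\cdot)$ denotes the $L^2(\Omega)$ inner product (of scalar or vector functions); $H^m(\Omega)$, $H_0^1(\Omega)$, $H_0^2(\Omega)$ are the standard Sobolev spaces. The first problem is the primal weak form of $\varepsilon^2\triangle^2u-\triangle u=f$ in $\Omega$ with $u=\partial u/\partial\mathbf{n}=0$ on $\partial\Omega$; the second is its mixed weak form with $\psi=-\triangle u$. Both problems are taken to be uniquely solvable. *)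

theory Defs
  imports "HOL-Analysis.Analysis"
begin

section \<open>The domain\<close>

text \<open>Near every boundary point, in suitable orthonormal coordinates with vertical unit vector
  \<open>e\<close>, the set is the region strictly below the graph of a Lipschitz function \<open>g\<close> of the
  horizontal component \<open>x - (x \<bullet> e) e\<close>.\<close>

definition lipschitz_boundary :: "(real^'d) set \<Rightarrow> bool" where
  "lipschitz_boundary \<Omega> \<longleftrightarrow>
     (\<forall>p \<in> frontier \<Omega>. \<exists>U e g L. open U \<and> p \<in> U \<and> norm e = 1 \<and>
        L-lipschitz_on {y. y \<bullet> e = 0} (g :: real^'d \<Rightarrow> real) \<and>
        \<Omega> \<inter> U = {x \<in> U. x \<bullet> e < g (x - (x \<bullet> e) *\<^sub>R e)})"

text \<open>Polygonal (\<open>d = 2\<close>) or polyhedral (\<open>d = 3\<close>): the boundary is a finite union of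
  segments, respectively of plane convex polygons.\<close>

definition polyhedral_boundary :: "(real^'d) set \<Rightarrow> bool" where
  "polyhedral_boundary \<Omega> \<longleftrightarrow>
     (\<exists>F. finite F \<and> (\<forall>P\<in>F. polytope P \<and> aff_dim P = int CARD('d) - 1) \<and> frontier \<Omega> = \<Union>F)"

definition polyhedral_lipschitz_domain :: "(real^'d) set \<Rightarrow> bool" where
  "polyhedral_lipschitz_domain \<Omega> \<longleftrightarrow>
     open \<Omega> \<and> connected \<Omega> \<and> \<Omega> \<noteq> {} \<and> bounded \<Omega> \<and>
     polyhedral_boundary \<Omega> \<and> lipschitz_boundary \<Omega>"


section \<open>Square integrable functions and weak derivatives\<close>

text \<open>Elements of \<open>L\<^sup>2(\<Omega>)\<close> are represented by functions on the whole space, of which only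
  the values on \<open>\<Omega>\<close> up to null sets matter; equality is \<open>ae_eq\<close>.\<close>

definition L2 :: "(real^'d) set \<Rightarrow> (real^'d \<Rightarrow> real) set" where
  "L2 \<Omega> = {f \<in> borel_measurable (lebesgue_on \<Omega>). integrable (lebesgue_on \<Omega>) (\<lambda>x. (f x)\<^sup>2)}"

definition ae_eq :: "(real^'d) set \<Rightarrow> (real^'d \<Rightarrow> real) \<Rightarrow> (real^'d \<Rightarrow> real) \<Rightarrow> bool" where
  "ae_eq \<Omega> f g \<longleftrightarrow> (AE x in lebesgue_on \<Omega>. f x = g x)"

text \<open>The inner product for scalar functions (\<open>\<bullet>\<close> on \<open>real\<close> is multiplication) and for
  vector fields.\<close>

definition l2_inner ::
    "(real^'d) set \<Rightarrow> (real^'d \<Rightarrow> 'b::euclidean_space) \<Rightarrow> (real^'d \<Rightarrow> 'b) \<Rightarrow> real" where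
  "l2_inner \<Omega> f g = (LINT x|lebesgue_on \<Omega>. f x \<bullet> g x)"

text \<open>A derivative of order \<open>m\<close> is indexed by the list (of length \<open>m\<close>) of the coordinates
  with respect to which one differentiates.\<close>

definition partial :: "'d \<Rightarrow> (real^'d \<Rightarrow> real) \<Rightarrow> real^'d \<Rightarrow> real" where
  "partial i f = (\<lambda>x. frechet_derivative f (at x) (axis i 1))"

definition partials :: "'d list \<Rightarrow> (real^'d \<Rightarrow> real) \<Rightarrow> real^'d \<Rightarrow> real" where
  "partials is f = foldr partial is f"

text \<open>All iterated partial derivatives are differentiable, hence continuous, so this is the usual
  notion of a \<open>C\<^sup>\<infinity>\<close> function.\<close>

definition smooth :: "(real^'d \<Rightarrow> real) \<Rightarrow> bool" where
  "smooth f \<longleftrightarrow> (\<forall>is x. partials is f differentiable (at x))"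

definition test_fun :: "(real^'d) set \<Rightarrow> (real^'d \<Rightarrow> real) \<Rightarrow> bool" where
  "test_fun \<Omega> \<phi> \<longleftrightarrow>
     smooth \<phi> \<and> compact (closure {x. \<phi> x \<noteq> 0}) \<and> closure {x. \<phi> x \<noteq> 0} \<subseteq> \<Omega>"

definition has_weak_deriv ::
    "(real^'d) set \<Rightarrow> 'd list \<Rightarrow> (real^'d \<Rightarrow> real) \<Rightarrow> (real^'d \<Rightarrow> real) \<Rightarrow> bool" where
  "has_weak_deriv \<Omega> is u g \<longleftrightarrow>
     (\<forall>\<phi>. test_fun \<Omega> \<phi> \<longrightarrow>
        l2_inner \<Omega> u (partials is \<phi>) = (-1) ^ length is * l2_inner \<Omega> g \<phi>)"

text \<open>A representative of the weak derivative, which is determined up to null sets if it exists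
  in \<open>L\<^sup>2(\<Omega>)\<close>; it is used only for functions having such a derivative.\<close>

definition weak_deriv :: "(real^'d) set \<Rightarrow> 'd list \<Rightarrow> (real^'d \<Rightarrow> real) \<Rightarrow> real^'d \<Rightarrow> real" where
  "weak_deriv \<Omega> is u = (SOME g. g \<in> L2 \<Omega> \<and> has_weak_deriv \<Omega> is u g)"

definition grad :: "(real^'d) set \<Rightarrow> (real^'d \<Rightarrow> real) \<Rightarrow> real^'d \<Rightarrow> real^'d" where
  "grad \<Omega> u = (\<lambda>x. \<chi> i. weak_deriv \<Omega> [i] u x)"

definition laplacian :: "(real^'d) set \<Rightarrow> (real^'d \<Rightarrow> real) \<Rightarrow> real^'d \<Rightarrow> real" where
  "laplacian \<Omega> u = (\<lambda>x. \<Sum>i\<in>UNIV. weak_deriv \<Omega> [i, i] u x)"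


section \<open>Sobolev spaces\<close>

definition sobolev :: "nat \<Rightarrow> (real^'d) set \<Rightarrow> (real^'d \<Rightarrow> real) set" where
  "sobolev m \<Omega> = {u \<in> L2 \<Omega>. \<forall>is. length is \<le> m \<longrightarrow> (\<exists>g \<in> L2 \<Omega>. has_weak_deriv \<Omega> is u g)}"

text \<open>Mixed derivatives are counted once for each order of differentiation, which gives a norm
  equivalent to the one summing over multi-indices.\<close>

definition sobolev_norm :: "nat \<Rightarrow> (real^'d) set \<Rightarrow> (real^'d \<Rightarrow> real) \<Rightarrow> real" where
  "sobolev_norm m \<Omega> u =
     sqrt (\<Sum>is | length is \<le> m. l2_inner \<Omega> (weak_deriv \<Omega> is u) (weak_deriv \<Omega> is u))"

text \<open>The closure of the test functions in \<open>H\<^sup>m(\<Omega>)\<close>.\<close>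

definition sobolev0 :: "nat \<Rightarrow> (real^'d) set \<Rightarrow> (real^'d \<Rightarrow> real) set" where
  "sobolev0 m \<Omega> =
     {u \<in> sobolev m \<Omega>. \<exists>\<phi>. (\<forall>n. test_fun \<Omega> (\<phi> n)) \<and>
        (\<lambda>n. sobolev_norm m \<Omega> (\<lambda>x. \<phi> n x - u x)) \<longlonglongrightarrow> 0}"


section \<open>The two weak problems\<close>

definition primal_solution ::
    "(real^'d) set \<Rightarrow> real \<Rightarrow> (real^'d \<Rightarrow> real) \<Rightarrow> (real^'d \<Rightarrow> real) \<Rightarrow> bool" where
  "primal_solution \<Omega> \<epsilon> f w \<longleftrightarrow> w \<in> sobolev0 2 \<Omega> \<and>
     (\<forall>v \<in> sobolev0 2 \<Omega>.
        \<epsilon>\<^sup>2 * l2_inner \<Omega> (laplacian \<Omega> w) (laplacian \<Omega> v) + l2_inner \<Omega> (grad \<Omega> w) (grad \<Omega> v)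
          = l2_inner \<Omega> f v)"

definition mixed_solution ::
    "(real^'d) set \<Rightarrow> real \<Rightarrow> (real^'d \<Rightarrow> real) \<Rightarrow> (real^'d \<Rightarrow> real) \<Rightarrow> (real^'d \<Rightarrow> real) \<Rightarrow> bool" where
  "mixed_solution \<Omega> \<epsilon> f \<psi> u \<longleftrightarrow> \<psi> \<in> sobolev 1 \<Omega> \<and> u \<in> sobolev0 1 \<Omega> \<and>
     (\<forall>\<phi> \<in> sobolev0 1 \<Omega>.
        \<epsilon>\<^sup>2 * l2_inner \<Omega> (grad \<Omega> \<psi>) (grad \<Omega> \<phi>) + l2_inner \<Omega> \<psi> \<phi> = l2_inner \<Omega> f \<phi>) \<and>
     (\<forall>v \<in> sobolev 1 \<Omega>. l2_inner \<Omega> (grad \<Omega> u) (grad \<Omega> v) = l2_inner \<Omega> \<psi> v)"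

definition primal_uniquely_solvable ::
    "(real^'d) set \<Rightarrow> real \<Rightarrow> (real^'d \<Rightarrow> real) \<Rightarrow> bool" where
  "primal_uniquely_solvable \<Omega> \<epsilon> f \<longleftrightarrow>
     (\<exists>w. primal_solution \<Omega> \<epsilon> f w) \<and>
     (\<forall>w w'. primal_solution \<Omega> \<epsilon> f w \<and> primal_solution \<Omega> \<epsilon> f w' \<longrightarrow> ae_eq \<Omega> w w')"

definition mixed_uniquely_solvable ::
    "(real^'d) set \<Rightarrow> real \<Rightarrow> (real^'d \<Rightarrow> real) \<Rightarrow> bool" where
  "mixed_uniquely_solvable \<Omega> \<epsilon> f \<longleftrightarrow>
     (\<exists>\<psi> u. mixed_solution \<Omega> \<epsilon> f \<psi> u) \<and>
     (\<forall>\<psi> u \<psi>' u'. mixed_solution \<Omega> \<epsilon> f \<psi> u \<and> mixed_solution \<Omega> \<epsilon> f \<psi>' u' \<longrightarrow>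
        ae_eq \<Omega> \<psi> \<psi>' \<and> ae_eq \<Omega> u u')"

end

theory Submission
  imports Defs
begin

text \<open>
  The two problems test the same equation against different functions, and the link between them is
  integration by parts. Let \<open>(\<psi>, u)\<close> solve the mixed problem with \<open>u \<in> H\<^sub>0\<^sup>2(\<Omega>)\<close>, and let
  \<open>\<phi>\<close> be a test function. Then \<open>\<zeta> = \<partial>\<^sub>i\<partial>\<^sub>i\<phi>\<close> is again a test function, and
  \<open>(\<triangle>u, \<zeta>) = -(\<nabla>u, \<nabla>\<zeta>) = -(\<psi>, \<zeta>) = (\<partial>\<^sub>i\<psi>, \<partial>\<^sub>i\<phi>)\<close>, where the
  first and the last equality define weak derivatives and the middle one is the second mixed
  equation. Summing over \<open>i\<close> gives \<open>(\<triangle>u, \<triangle>\<phi>) = (\<nabla>\<psi>, \<nabla>\<phi>)\<close>; since also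
  \<open>(\<nabla>u, \<nabla>\<phi>) = (\<psi>, \<phi>)\<close>, the first mixed equation becomes the primal equation for \<open>u\<close>
  tested with \<open>\<phi>\<close> (lemma \<open>mixed_solution_primal_equation_test_fun\<close>). Both sides are continuous in
  \<open>\<phi>\<close> for the \<open>H\<^sup>2\<close> norm, so the equation holds on all of \<open>H\<^sub>0\<^sup>2(\<Omega>)\<close> (lemma
  \<open>primal_solution_if_test_funs\<close>), and uniqueness of the primal solution identifies \<open>u\<close> with
  \<open>ut\<close>. In the other direction \<open>u\<close> agrees almost everywhere with a function of
  \<open>H\<^sub>0\<^sup>2(\<Omega>)\<close>, and membership in that space only depends on the almost everywhere class
  (lemma \<open>sobolev0_cong\<close>).

  This computation treats \<open>weak_deriv\<close>, which is an arbitrary choice among the weak derivatives, as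
  a linear operation that extends the classical derivative of test functions. Both properties rest
  on uniqueness of weak derivatives up to null sets, that is on the fundamental lemma of the calculus
  of variations (lemma \<open>ae_eq_0_if_orthogonal_to_test_funs\<close>), for which the indicator functions of
  boxes are approximated by smooth bumps, and on integration by parts for test functions (lemma
  \<open>l2_inner_partial\<close>).
\<close>

section \<open>The space of square integrable functions\<close>

lemma L2D:
  assumes "f \<in> L2 \<Omega>"
  shows "f \<in> borel_measurable (lebesgue_on \<Omega>)" "integrable (lebesgue_on \<Omega>) (\<lambda>x. (f x)\<^sup>2)"
  using assms by (auto simp: L2_def)

lemma integrable_mult_L2:
  assumes "f \<in> L2 \<Omega>" "g \<in> L2 \<Omega>"
  shows "integrable (lebesgue_on \<Omega>) (\<lambda>x. f x * g x)"
proof (rule Bochner_Integration.integrable_bound)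
  show "integrable (lebesgue_on \<Omega>) (\<lambda>x. (f x)\<^sup>2 + (g x)\<^sup>2)"
    using L2D(2)[OF assms(1)] L2D(2)[OF assms(2)] by simp
  show "(\<lambda>x. f x * g x) \<in> borel_measurable (lebesgue_on \<Omega>)"
    using L2D(1)[OF assms(1)] L2D(1)[OF assms(2)] by simp
  have "\<bar>a * b\<bar> \<le> a\<^sup>2 + b\<^sup>2" for a b :: real
    using sum_squares_bound[of "\<bar>a\<bar>" "\<bar>b\<bar>"] mult_nonneg_nonneg[of "\<bar>a\<bar>" "\<bar>b\<bar>"]
    unfolding abs_mult power2_abs by linarith
  then show "AE x in lebesgue_on \<Omega>. norm (f x * g x) \<le> norm ((f x)\<^sup>2 + (g x)\<^sup>2)"
    by (intro AE_I2) (simp add: order_trans[OF _ abs_ge_self])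
qed

lemma L2_zero [simp]: "(\<lambda>x. 0) \<in> L2 \<Omega>"
  by (simp add: L2_def)

lemma L2_cmult [intro]: "f \<in> L2 \<Omega> \<Longrightarrow> (\<lambda>x. c * f x) \<in> L2 \<Omega>"
  by (auto simp: L2_def power_mult_distrib)

lemma L2_add [intro]:
  assumes "f \<in> L2 \<Omega>" "g \<in> L2 \<Omega>"
  shows "(\<lambda>x. f x + g x) \<in> L2 \<Omega>"
  using assms integrable_mult_L2[OF assms]
  by (auto simp: L2_def power2_sum mult.assoc)

lemma L2_diff [intro]:
  assumes "f \<in> L2 \<Omega>" "g \<in> L2 \<Omega>"
  shows "(\<lambda>x. f x - g x) \<in> L2 \<Omega>"
  using L2_add[OF assms(1) L2_cmult[OF assms(2), of "-1"]] by simp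

lemma L2_sum [intro]:
  assumes "\<And>i. i \<in> I \<Longrightarrow> f i \<in> L2 \<Omega>"
  shows "(\<lambda>x. \<Sum>i\<in>I. f i x) \<in> L2 \<Omega>"
  using assms by (induction I rule: infinite_finite_induct) auto

lemma l2_inner_commute: "l2_inner \<Omega> f g = l2_inner \<Omega> g f"
  by (simp add: l2_inner_def inner_commute)

lemma l2_inner_cmult: "l2_inner \<Omega> (\<lambda>x. c * f x) g = c * l2_inner \<Omega> f (g :: _ \<Rightarrow> real)"
  by (simp add: l2_inner_def mult.assoc)

lemma l2_inner_diff:
  fixes f g h :: "real^'d \<Rightarrow> real"
  assumes "f \<in> L2 \<Omega>" "g \<in> L2 \<Omega>" "h \<in> L2 \<Omega>"
  shows "l2_inner \<Omega> (\<lambda>x. f x - g x) h = l2_inner \<Omega> f h - l2_inner \<Omega> g h"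
  using integrable_mult_L2[OF assms(1,3)] integrable_mult_L2[OF assms(2,3)]
  by (simp add: l2_inner_def left_diff_distrib)

lemma l2_inner_sum:
  fixes h :: "real^'d \<Rightarrow> real"
  assumes "\<And>i. i \<in> I \<Longrightarrow> f i \<in> L2 \<Omega>" "h \<in> L2 \<Omega>"
  shows "l2_inner \<Omega> (\<lambda>x. \<Sum>i\<in>I. f i x) h = (\<Sum>i\<in>I. l2_inner \<Omega> (f i) h)"
  using assms by (simp add: l2_inner_def sum_distrib_right integrable_mult_L2)

lemma l2_inner_cong_AE:
  fixes f f' g g' :: "real^'d \<Rightarrow> real"
  assumes "ae_eq \<Omega> f f'" "ae_eq \<Omega> g g'" "f \<in> L2 \<Omega>" "f' \<in> L2 \<Omega>" "g \<in> L2 \<Omega>" "g' \<in> L2 \<Omega>"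
  shows "l2_inner \<Omega> f g = l2_inner \<Omega> f' g'"
  unfolding l2_inner_def
proof (rule integral_cong_AE)
  show "AE x in lebesgue_on \<Omega>. f x \<bullet> g x = f' x \<bullet> g' x"
    using assms(1,2) unfolding ae_eq_def by eventually_elim simp
qed (use assms in \<open>auto simp: L2_def\<close>)

lemma l2_inner_self_nonneg: "0 \<le> l2_inner \<Omega> f (f :: _ \<Rightarrow> real)"
  by (simp add: l2_inner_def)

text \<open>A quadratic polynomial in \<open>t\<close>, namely \<open>\<parallel>f - t g\<parallel>\<^sup>2\<close>, is nowhere negative, so its
  discriminant is not positive.\<close>

lemma l2_cauchy_schwarz:
  fixes f g :: "real^'d \<Rightarrow> real"
  assumes "f \<in> L2 \<Omega>" "g \<in> L2 \<Omega>"
  shows "\<bar>l2_inner \<Omega> f g\<bar> \<le> sqrt (l2_inner \<Omega> f f) * sqrt (l2_inner \<Omega> g g)"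
proof -
  let ?a = "l2_inner \<Omega> f f" and ?b = "l2_inner \<Omega> f g" and ?c = "l2_inner \<Omega> g g"
  have quad: "0 \<le> ?a - 2 * t * ?b + t\<^sup>2 * ?c" for t
  proof -
    let ?h = "\<lambda>x. f x - t * g x"
    have h: "?h \<in> L2 \<Omega>" and tg: "(\<lambda>x. t * g x) \<in> L2 \<Omega>"
      using assms by auto
    have "l2_inner \<Omega> ?h ?h = l2_inner \<Omega> f ?h - t * l2_inner \<Omega> g ?h"
      using l2_inner_diff[OF assms(1) tg h] by (simp only: l2_inner_cmult)
    also have "\<dots> = l2_inner \<Omega> ?h f - t * l2_inner \<Omega> ?h g"
      by (simp only: l2_inner_commute[of \<Omega> f ?h] l2_inner_commute[of \<Omega> g ?h])
    also have "\<dots> = ?a - 2 * t * ?b + t\<^sup>2 * ?c"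
      using l2_inner_diff[OF assms(1) tg assms(1)] l2_inner_diff[OF assms(1) tg assms(2)]
      by (simp only: l2_inner_cmult l2_inner_commute[of \<Omega> g f])
        (simp add: power2_eq_square algebra_simps)
    finally show ?thesis
      using l2_inner_self_nonneg[of \<Omega> ?h] by simp
  qed
  have "?b\<^sup>2 \<le> ?a * ?c"
  proof (cases "?c = 0")
    case True
    have "?b = 0"
    proof (rule ccontr)
      assume "?b \<noteq> 0"
      \<comment> \<open>The polynomial is affine in \<open>t\<close> here and takes the value \<open>-1\<close> at this point.\<close>
      then show False
        using quad[of "(?a + 1) / (2 * ?b)"] True by simp
    qed
    then show ?thesis using True by simp
  next
    case False
    then have c: "?c > 0" using l2_inner_self_nonneg[of \<Omega> g] by simp
    have "0 \<le> ?c * (?a - 2 * (?b / ?c) * ?b + (?b / ?c)\<^sup>2 * ?c)"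
      using c quad[of "?b / ?c"] by (intro mult_nonneg_nonneg) auto
    also have "\<dots> = ?a * ?c - ?b\<^sup>2"
      using c by (simp add: field_simps power2_eq_square)
    finally show ?thesis by simp
  qed
  then have "sqrt (?b\<^sup>2) \<le> sqrt (?a * ?c)"
    by (rule real_sqrt_le_mono)
  then show ?thesis by (simp add: real_sqrt_mult)
qed

lemma l2_inner_grad:
  fixes \<Omega> :: "(real^'d) set"
  assumes "\<And>i. weak_deriv \<Omega> [i] u \<in> L2 \<Omega>" "\<And>i. weak_deriv \<Omega> [i] v \<in> L2 \<Omega>"
  shows "l2_inner \<Omega> (grad \<Omega> u) (grad \<Omega> v)
       = (\<Sum>i\<in>UNIV. l2_inner \<Omega> (weak_deriv \<Omega> [i] u) (weak_deriv \<Omega> [i] v))"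
  using assms by (simp add: l2_inner_def grad_def inner_vec_def integrable_mult_L2)


section \<open>Smooth functions and integration by parts\<close>

lemma partial_eq:
  assumes "(f has_derivative f') (at x)"
  shows "partial i f x = f' (axis i 1)"
  using frechet_derivative_at[OF assms] by (simp add: partial_def)

lemma partials_simps [simp]:
  "partials [] f = f" "partials (i # is) f = partial i (partials is f)"
  "partials (is @ js) f = partials is (partials js f)"
  by (simp_all add: partials_def)

lemma partials_snoc: "partials (is @ [i]) f = partials is (partial i f)"
  by simp

lemma smooth_partial: "smooth f \<Longrightarrow> smooth (partial i f)"
  unfolding smooth_def by (metis partials_snoc)

lemma smooth_differentiable: "smooth f \<Longrightarrow> f differentiable (at x)"
  using partials_simps(1)[of f] unfolding smooth_def by metis

lemma smooth_continuous: "smooth f \<Longrightarrow> continuous_on S f"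
  by (simp add: smooth_differentiable differentiable_imp_continuous_within
      continuous_at_imp_continuous_on)

lemma smooth_borel: "smooth f \<Longrightarrow> f \<in> borel_measurable borel"
  by (simp add: smooth_continuous borel_measurable_continuous_onI)

lemma test_fun_smooth: "test_fun \<Omega> \<phi> \<Longrightarrow> smooth \<phi>"
  by (simp add: test_fun_def)

lemma eq_0_outside_support: "x \<notin> closure {x. f x \<noteq> 0} \<Longrightarrow> f x = 0"
  using closure_subset[of "{x. f x \<noteq> 0}"] by auto

lemma test_fun_eq_0:
  assumes "test_fun \<Omega> \<phi>" "x \<notin> \<Omega>"
  shows "\<phi> x = 0"
proof (rule eq_0_outside_support[of x \<phi>])
  show "x \<notin> closure {x. \<phi> x \<noteq> 0}"
    using assms by (auto simp: test_fun_def)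
qed

lemma partial_eq_0_outside_support:
  assumes "x \<notin> closure {x. f x \<noteq> 0}"
  shows "partial i f x = 0"
proof -
  have "(f has_derivative (\<lambda>_. 0)) (at x)"
  proof (rule has_derivative_transform_within_open[of "\<lambda>_. 0" _ _ UNIV "- closure {x. f x \<noteq> 0}"])
    show "0 = f y" if "y \<in> - closure {x. f x \<noteq> 0}" for y
      using eq_0_outside_support[of y f] that by simp
  qed (use assms in \<open>auto simp: open_Compl\<close>)
  then show ?thesis by (simp add: partial_eq)
qed

lemma support_partial: "closure {x. partial i f x \<noteq> 0} \<subseteq> closure {x. f x \<noteq> 0}"
  using partial_eq_0_outside_support[of _ f i] by (intro closure_minimal) auto

lemma test_fun_partial:
  assumes "test_fun \<Omega> \<phi>"
  shows "test_fun \<Omega> (partial i \<phi>)"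
  unfolding test_fun_def
proof (intro conjI)
  show "smooth (partial i \<phi>)"
    using assms by (intro smooth_partial test_fun_smooth)
  show "compact (closure {x. partial i \<phi> x \<noteq> 0})"
    using compact_Int_closed[of "closure {x. \<phi> x \<noteq> 0}" "closure {x. partial i \<phi> x \<noteq> 0}"]
      assms support_partial[of i \<phi>] by (simp add: test_fun_def Int_absorb1)
  show "closure {x. partial i \<phi> x \<noteq> 0} \<subseteq> \<Omega>"
    using assms support_partial[of i \<phi>] by (auto simp: test_fun_def)
qed

lemma test_fun_partials: "test_fun \<Omega> \<phi> \<Longrightarrow> test_fun \<Omega> (partials is \<phi>)"
  by (induction "is") (auto intro: test_fun_partial)

lemma indicator_scaleR_eq:
  "(\<And>x. x \<notin> S \<Longrightarrow> f x = (0::real)) \<Longrightarrow> (\<lambda>x. indicator S x *\<^sub>R f x) = f"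
  by (auto simp: fun_eq_iff indicator_def)

lemma integrable_lborel_compact_support:
  fixes f :: "real^'d \<Rightarrow> real"
  assumes "continuous_on UNIV f" "compact K" "\<And>x. x \<notin> K \<Longrightarrow> f x = 0"
  shows "integrable lborel f"
proof -
  have "integrable lborel (\<lambda>x. indicator K x *\<^sub>R f x)"
    using assms by (intro borel_integrable_compact) (auto intro: continuous_on_subset)
  also have "(\<lambda>x. indicator K x *\<^sub>R f x) = f"
    by (rule indicator_scaleR_eq) (rule assms(3))
  finally show ?thesis .
qed

lemma test_fun_in_L2:
  fixes \<Omega> :: "(real^'d) set"
  assumes "open \<Omega>" "test_fun \<Omega> \<phi>"
  shows "\<phi> \<in> L2 \<Omega>"
proof -
  note sm = test_fun_smooth[OF assms(2)]
  have b: "\<phi> \<in> borel_measurable borel"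
    by (rule smooth_borel[OF sm])
  have "integrable lborel (\<lambda>x. (\<phi> x)\<^sup>2)"
  proof (rule integrable_lborel_compact_support)
    show "compact (closure {x. \<phi> x \<noteq> 0})" using assms by (simp add: test_fun_def)
    show "(\<phi> x)\<^sup>2 = 0" if "x \<notin> closure {x. \<phi> x \<noteq> 0}" for x
      using eq_0_outside_support[OF that] by simp
  qed (intro continuous_intros smooth_continuous sm)
  then have "integrable lebesgue (\<lambda>x. (\<phi> x)\<^sup>2)"
    using b by (simp add: integrable_completion)
  moreover have "(\<lambda>x. indicator \<Omega> x *\<^sub>R (\<phi> x)\<^sup>2) = (\<lambda>x. (\<phi> x)\<^sup>2)"
    by (rule indicator_scaleR_eq) (simp add: test_fun_eq_0[OF assms(2)])
  ultimately have "integrable (lebesgue_on \<Omega>) (\<lambda>x. (\<phi> x)\<^sup>2)"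
    using assms(1) by (simp add: integrable_restrict_space)
  moreover have "\<phi> \<in> borel_measurable (lebesgue_on \<Omega>)"
    using b by (simp add: measurable_completion measurable_restrict_space1)
  ultimately show ?thesis by (simp add: L2_def)
qed

lemma l2_inner_eq_lborel:
  fixes f g :: "real^'d \<Rightarrow> real"
  assumes "open \<Omega>" "f \<in> borel_measurable borel" "g \<in> borel_measurable borel"
    "\<And>x. x \<notin> \<Omega> \<Longrightarrow> f x * g x = 0"
  shows "l2_inner \<Omega> f g = (\<integral>x. f x * g x \<partial>lborel)"
proof -
  have "l2_inner \<Omega> f g = (\<integral>x. indicator \<Omega> x *\<^sub>R (f x * g x) \<partial>lebesgue)"
    using assms(1) by (simp add: l2_inner_def integral_restrict_space)
  also have "(\<lambda>x. indicator \<Omega> x *\<^sub>R (f x * g x)) = (\<lambda>x. f x * g x)"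
    by (rule indicator_scaleR_eq) (rule assms(4))
  finally show ?thesis
    using assms(2,3) by (simp add: integral_completion)
qed


text \<open>Lebesgue measure is translation invariant, so all difference quotients of \<open>F\<close> in the
  direction of the \<open>i\<close>-th axis have integral zero; the integral of the partial derivative is their
  limit by dominated convergence.\<close>

lemma integral_partial_eq_0:
  fixes F :: "real^'d \<Rightarrow> real"
  assumes diff: "\<And>x. F differentiable (at x)" and cont: "continuous_on UNIV (partial i F)"
    and K: "compact K" "\<And>x. x \<notin> K \<Longrightarrow> F x = 0"
  shows "(\<integral>x. partial i F x \<partial>lborel) = 0"
proof -
  let ?e = "axis i 1 :: real^'d"
  have F_cont: "continuous_on UNIV F"
    by (simp add: diff differentiable_imp_continuous_within continuous_at_imp_continuous_on)
  have F_int: "integrable lborel F"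
    using F_cont K by (rule integrable_lborel_compact_support)
  have F_borel: "F \<in> borel_measurable borel"
    using F_cont by (rule borel_measurable_continuous_onI)
  obtain R where R: "\<And>x. x \<in> K \<Longrightarrow> norm x \<le> R"
    using compact_imp_bounded[OF K(1)] by (auto simp: bounded_iff)
  have "compact (partial i F ` cball 0 (R + 2))"
    by (intro compact_continuous_image continuous_on_subset[OF cont]) auto
  then obtain M where M: "\<And>x. norm x \<le> R + 2 \<Longrightarrow> \<bar>partial i F x\<bar> \<le> M"
    using compact_imp_bounded by (fastforce simp: bounded_iff)
  have line: "((\<lambda>t. F (x + t *\<^sub>R ?e)) has_real_derivative partial i F (x + t *\<^sub>R ?e)) (at t)" for x t
  proof -
    let ?F' = "frechet_derivative F (at (x + t *\<^sub>R ?e))"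
    have F': "(F has_derivative ?F') (at (x + t *\<^sub>R ?e))"
      using diff frechet_derivative_works by blast
    have "((\<lambda>t. x + t *\<^sub>R ?e) has_derivative (\<lambda>h. h *\<^sub>R ?e)) (at t)"
      by (auto intro!: derivative_eq_intros)
    from has_derivative_compose[OF this F']
    have "((\<lambda>t. F (x + t *\<^sub>R ?e)) has_derivative (\<lambda>h. ?F' (h *\<^sub>R ?e))) (at t)" .
    moreover have "(\<lambda>h. ?F' (h *\<^sub>R ?e)) = (\<lambda>h. partial i F (x + t *\<^sub>R ?e) * h)"
      using linear_scale[OF has_derivative_linear[OF F']] by (simp add: partial_def mult.commute)
    ultimately show ?thesis by (simp add: has_field_derivative_def)
  qed
  define s :: "nat \<Rightarrow> real" where "s n = inverse (real (Suc n))" for n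
  have s: "0 < s n" "s n \<le> 1" for n
    by (simp_all add: s_def inverse_le_1_iff)
  have s_lim: "filterlim s (at 0) sequentially"
    unfolding filterlim_at using LIMSEQ_inverse_real_of_nat s(1)
    by (auto simp: s_def[abs_def] less_imp_neq eventually_sequentially)
  define D where "D n x = (F (s n *\<^sub>R ?e + x) - F x) / s n" for n x
  have transl: "integrable lborel (\<lambda>x. F (c + x))" "(\<integral>x. F (c + x) \<partial>lborel) = (\<integral>x. F x \<partial>lborel)" for c
    using integrable_distr_eq[of "(+) c" lborel borel F] integral_distr[of "(+) c" lborel borel F]
      F_borel F_int by (simp_all add: lborel_distr_plus)
  have D_int: "(\<integral>x. D n x \<partial>lborel) = 0" for n
    unfolding D_def using transl F_int by simp
  have "(\<lambda>n. \<integral>x. D n x \<partial>lborel) \<longlonglongrightarrow> (\<integral>x. partial i F x \<partial>lborel)"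
  proof (rule integral_dominated_convergence[where w = "\<lambda>x. M * indicator (cball 0 (R + 1)) x"])
    show "partial i F \<in> borel_measurable lborel"
      using cont by (simp add: borel_measurable_continuous_onI)
    show "D n \<in> borel_measurable lborel" for n
      using F_borel unfolding D_def[abs_def] by measurable
    show "integrable lborel (\<lambda>x. M * indicator (cball 0 (R + 1)) (x :: real^'d))"
      by (intro integrable_mult_right integrable_real_indicator emeasure_bounded_finite) auto
    show "AE x in lborel. (\<lambda>n. D n x) \<longlonglongrightarrow> partial i F x"
    proof (rule AE_I2)
      fix x
      have "((\<lambda>h. (F (x + h *\<^sub>R ?e) - F x) / h) \<longlongrightarrow> partial i F x) (at 0)"
        using line[of x 0] by (simp add: DERIV_def)
      from filterlim_compose[OF this s_lim] show "(\<lambda>n. D n x) \<longlonglongrightarrow> partial i F x"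
        by (simp add: D_def add.commute)
    qed
    show "AE x in lborel. norm (D n x) \<le> M * indicator (cball 0 (R + 1)) x" for n
    proof (rule AE_I2)
      fix x :: "real^'d"
      show "norm (D n x) \<le> M * indicator (cball 0 (R + 1)) x"
      proof (cases "norm x \<le> R + 1")
        case True
        obtain z where z: "0 < z" "z < s n"
          "F (x + s n *\<^sub>R ?e) - F (x + 0 *\<^sub>R ?e) = (s n - 0) * partial i F (x + z *\<^sub>R ?e)"
          using MVT2[of 0 "s n" "\<lambda>t. F (x + t *\<^sub>R ?e)" "\<lambda>t. partial i F (x + t *\<^sub>R ?e)"] line s(1)
          by blast
        have "norm (x + z *\<^sub>R ?e) \<le> norm x + norm (z *\<^sub>R ?e)"
          by (rule norm_triangle_ineq)
        also have "\<dots> \<le> R + 2"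
          using True z s(2)[of n] by simp
        finally have "\<bar>partial i F (x + z *\<^sub>R ?e)\<bar> \<le> M" by (rule M)
        moreover have "D n x = partial i F (x + z *\<^sub>R ?e)"
          using z s(1)[of n] by (simp add: D_def add.commute)
        ultimately show ?thesis using True by simp
      next
        case False
        have "norm x - norm (s n *\<^sub>R ?e) \<le> norm (s n *\<^sub>R ?e + x)"
          by (metis add.commute norm_diff_ineq)
        then have "R < norm (s n *\<^sub>R ?e + x)" "R < norm x"
          using False s[of n] by simp_all
        then have "F (s n *\<^sub>R ?e + x) = 0" "F x = 0"
          using R K(2) by (meson not_le)+
        then show ?thesis using False by (simp add: D_def)
      qed
    qed
  qed
  then show ?thesis
    by (simp add: D_int LIMSEQ_const_iff)
qed

lemma l2_inner_partial:
  fixes \<Omega> :: "(real^'d) set"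
  assumes "open \<Omega>" "test_fun \<Omega> \<phi>" "test_fun \<Omega> \<eta>"
  shows "l2_inner \<Omega> \<phi> (partial i \<eta>) = - l2_inner \<Omega> (partial i \<phi>) \<eta>"
proof -
  let ?K = "closure {x. \<phi> x \<noteq> 0}"
  note sm = assms(2,3)[THEN test_fun_smooth]
  note sm' = sm[THEN smooth_partial[where i = i]]
  have K: "compact ?K" using assms(2) by (simp add: test_fun_def)
  have K0: "\<phi> x = 0" "partial i \<phi> x = 0" if "x \<notin> ?K" for x
    using eq_0_outside_support[of x \<phi>] partial_eq_0_outside_support[of x \<phi>] that by auto
  have prod: "((\<lambda>x. \<phi> x * \<eta> x) has_derivative
      (\<lambda>h. \<phi> x * frechet_derivative \<eta> (at x) h + frechet_derivative \<phi> (at x) h * \<eta> x)) (at x)" for x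
    by (intro has_derivative_mult iffD1[OF frechet_derivative_works] smooth_differentiable sm)
  have part: "partial i (\<lambda>x. \<phi> x * \<eta> x) = (\<lambda>x. \<phi> x * partial i \<eta> x + partial i \<phi> x * \<eta> x)"
  proof (rule ext)
    show "partial i (\<lambda>x. \<phi> x * \<eta> x) x = \<phi> x * partial i \<eta> x + partial i \<phi> x * \<eta> x" for x
      using partial_eq[OF prod[of x], of i] by (simp only: partial_def[of i \<phi>] partial_def[of i \<eta>])
  qed
  have int: "integrable lborel (\<lambda>x. \<phi> x * partial i \<eta> x)" "integrable lborel (\<lambda>x. partial i \<phi> x * \<eta> x)"
  proof -
    have zero: "\<phi> x * partial i \<eta> x = 0" "partial i \<phi> x * \<eta> x = 0" if "x \<notin> ?K" for x
      using K0[OF that] by simp_all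
    show "integrable lborel (\<lambda>x. \<phi> x * partial i \<eta> x)"
      by (rule integrable_lborel_compact_support[OF _ K zero(1)])
        (intro continuous_on_mult smooth_continuous sm sm')
    show "integrable lborel (\<lambda>x. partial i \<phi> x * \<eta> x)"
      by (rule integrable_lborel_compact_support[OF _ K zero(2)])
        (intro continuous_on_mult smooth_continuous sm sm')
  qed
  have "(\<integral>x. partial i (\<lambda>x. \<phi> x * \<eta> x) x \<partial>lborel) = 0"
  proof (rule integral_partial_eq_0)
    show "(\<lambda>x. \<phi> x * \<eta> x) differentiable (at x)" for x
      using prod by (auto simp: differentiable_def)
    show "continuous_on UNIV (partial i (\<lambda>x. \<phi> x * \<eta> x))"
      unfolding part by (intro continuous_on_add continuous_on_mult smooth_continuous sm sm')
    show "\<phi> x * \<eta> x = 0" if "x \<notin> ?K" for x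
      using K0(1)[OF that] by simp
  qed (rule K)
  then have "(\<integral>x. \<phi> x * partial i \<eta> x \<partial>lborel) = - (\<integral>x. partial i \<phi> x * \<eta> x \<partial>lborel)"
    unfolding part using int by simp
  then show ?thesis
    using l2_inner_eq_lborel[OF assms(1), of \<phi> "partial i \<eta>"]
      l2_inner_eq_lborel[OF assms(1), of "partial i \<phi>" \<eta>]
      test_fun_eq_0[OF assms(2)] test_fun_eq_0[OF assms(3)]
      sm[THEN smooth_borel] sm'[THEN smooth_borel]
    by simp
qed

text \<open>Each integration by parts moves the outermost derivative of \<open>\<eta>\<close> to \<open>\<phi>\<close>, where it
  becomes the innermost one; hence the reversal of the list.\<close>

lemma l2_inner_partials:
  fixes \<Omega> :: "(real^'d) set"
  assumes "open \<Omega>" "test_fun \<Omega> \<phi>" "test_fun \<Omega> \<eta>"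
  shows "l2_inner \<Omega> \<phi> (partials is \<eta>) = (-1) ^ length is * l2_inner \<Omega> (partials (rev is) \<phi>) \<eta>"
  using assms(2)
proof (induction "is" arbitrary: \<phi>)
  case (Cons i "is")
  show ?case
    using Cons.IH[OF test_fun_partial[OF Cons.prems, of i]]
      l2_inner_partial[OF assms(1) Cons.prems test_fun_partials[OF assms(3)]]
    by simp
qed simp


section \<open>Smooth bumps on boxes\<close>

text \<open>The function \<open>exp (- 1 / t)\<close> vanishes to infinite order at \<open>0\<close>. The negative powers of \<open>t\<close>
  are carried along because they appear in its derivatives.\<close>

definition flat :: "nat \<Rightarrow> real \<Rightarrow> real" where
  "flat k t = (if t \<le> 0 then 0 else exp (- 1 / t) / t ^ k)"

lemma flat_tendsto_0: "(flat k \<longlongrightarrow> 0) (at 0)"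
proof -
  have "((\<lambda>t. flat k t) \<longlongrightarrow> 0) (at_right 0)"
  proof -
    have "((\<lambda>t. inverse t ^ k / exp (inverse t)) \<longlongrightarrow> (0::real)) (at_right 0)"
      by (rule filterlim_compose[OF tendsto_power_div_exp_0 filterlim_inverse_at_top_right])
    moreover have "eventually (\<lambda>t::real. inverse t ^ k / exp (inverse t) = flat k t) (at_right 0)"
      unfolding eventually_at_right_field
      by (intro exI[of _ 1]) (simp add: flat_def exp_minus power_inverse field_simps)
    ultimately show ?thesis using tendsto_cong by fast
  qed
  moreover have "((\<lambda>t. flat k t) \<longlongrightarrow> 0) (at_left 0)"
    by (rule tendsto_eventually)
      (auto simp: eventually_at_left_field flat_def intro!: exI[of _ "-1"])
  ultimately show ?thesis by (simp add: filterlim_at_split)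
qed

lemma flat_deriv: "(flat k has_real_derivative flat (k + 2) t - k * flat (k + 1) t) (at t)"
proof -
  consider "t < 0" | "t = 0" | "t > 0" by linarith
  then show ?thesis
  proof cases
    case 1
    have "((\<lambda>_. 0) has_real_derivative 0) (at t)" by simp
    then have "(flat k has_real_derivative 0) (at t)"
      by (rule has_field_derivative_transform_within_open[of _ _ _ "{..<0}"]) (use 1 in \<open>auto simp: flat_def\<close>)
    then show ?thesis using 1 by (simp add: flat_def)
  next
    case 2
    have "((\<lambda>h. (flat k (0 + h) - flat k 0) / h) \<longlongrightarrow> 0) (at 0)"
    proof (rule Lim_transform_eventually[OF flat_tendsto_0[of "Suc k"]])
      show "\<forall>\<^sub>F h in at 0. flat (Suc k) h = (flat k (0 + h) - flat k 0) / h"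
        by (simp add: flat_def eventually_at_filter)
    qed
    then show ?thesis using 2 by (simp add: DERIV_def flat_def)
  next
    case 3
    have "((\<lambda>t. exp (- 1 / t) / t ^ k) has_real_derivative flat (k + 2) t - k * flat (k + 1) t) (at t)"
    proof (cases k)
      case 0
      then show ?thesis using 3
        by (auto intro!: derivative_eq_intros simp: flat_def power2_eq_square)
    next
      case (Suc j)
      show ?thesis using 3 unfolding Suc
        by (auto intro!: derivative_eq_intros simp: flat_def field_simps power2_eq_square)
          (cases j; simp)
    qed
    then show ?thesis
      by (rule has_field_derivative_transform_within_open[of _ _ _ "{0<..}"]) (use 3 in \<open>auto simp: flat_def\<close>)
  qed
qed

text \<open>This class contains the bumps on boxes and is closed under partial derivatives, by
  \<open>flat_deriv\<close> and the product rule. All its members are therefore smooth, without a formula for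
  their higher derivatives.\<close>

inductive flat_algebra :: "(real^'d \<Rightarrow> real) \<Rightarrow> bool" where
  flat_algebra_const: "flat_algebra (\<lambda>x. c)"
| flat_algebra_flat: "flat_algebra (\<lambda>x. flat k (c * x $ i + d))"
| flat_algebra_add: "flat_algebra f \<Longrightarrow> flat_algebra g \<Longrightarrow> flat_algebra (\<lambda>x. f x + g x)"
| flat_algebra_mult: "flat_algebra f \<Longrightarrow> flat_algebra g \<Longrightarrow> flat_algebra (\<lambda>x. f x * g x)"

lemma flat_algebra_prod:
  "(\<And>i. i \<in> I \<Longrightarrow> flat_algebra (f i)) \<Longrightarrow> flat_algebra (\<lambda>x. \<Prod>i\<in>I. f i x)"
  by (induction I rule: infinite_finite_induct)
    (auto intro: flat_algebra_const flat_algebra_mult)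

lemma flat_algebra_has_derivative:
  fixes f :: "real^'d \<Rightarrow> real"
  assumes "flat_algebra f"
  shows "\<exists>f'. (\<forall>x. (f has_derivative f' x) (at x)) \<and> (\<forall>j. flat_algebra (\<lambda>x. f' x (axis j 1)))"
  using assms
proof induction
  case (flat_algebra_const c)
  show ?case
    by (intro exI[of _ "\<lambda>x h. 0"]) (auto intro: flat_algebra.intros)
next
  case (flat_algebra_flat k c i d)
  let ?f' = "\<lambda>x h. (flat (k + 2) (c * x $ i + d) + (- real k) * flat (k + 1) (c * x $ i + d)) * (c * h $ i)"
  have "((\<lambda>x. flat k (c * x $ i + d)) has_derivative ?f' x) (at x)" for x :: "real^'d"
  proof -
    have "((\<lambda>x::real^'d. c * x $ i + d) has_derivative (\<lambda>h. c * h $ i)) (at x)"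
      by (auto intro!: derivative_eq_intros bounded_linear.has_derivative[OF bounded_linear_vec_nth])
    from has_derivative_compose[OF this flat_deriv[unfolded has_field_derivative_def]]
    show ?thesis by simp
  qed
  then show ?case
    by (intro exI[of _ ?f'] conjI allI flat_algebra.intros) assumption
next
  case (flat_algebra_add f g)
  then obtain f' g' where *: "\<And>x. (f has_derivative f' x) (at x)" "\<And>x. (g has_derivative g' x) (at x)"
    "\<And>j. flat_algebra (\<lambda>x. f' x (axis j 1))" "\<And>j. flat_algebra (\<lambda>x. g' x (axis j 1))" by blast
  show ?case
    by (intro exI[of _ "\<lambda>x h. f' x h + g' x h"])
      (auto intro!: flat_algebra.flat_algebra_add has_derivative_add *)
next
  case (flat_algebra_mult f g)
  then obtain f' g' where *: "\<And>x. (f has_derivative f' x) (at x)" "\<And>x. (g has_derivative g' x) (at x)"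
    "\<And>j. flat_algebra (\<lambda>x. f' x (axis j 1))" "\<And>j. flat_algebra (\<lambda>x. g' x (axis j 1))" by blast
  show ?case
    by (intro exI[of _ "\<lambda>x h. f x * g' x h + f' x h * g x"] conjI allI)
      (intro has_derivative_mult * flat_algebra.flat_algebra_add flat_algebra.flat_algebra_mult
        flat_algebra_mult.hyps)+
qed

lemma flat_algebra_smooth:
  assumes "flat_algebra f"
  shows "smooth f"
proof -
  have "flat_algebra (partials is f)" for "is"
  proof (induction "is")
    case (Cons i "is")
    obtain f' where f': "\<And>x. (partials is f has_derivative f' x) (at x)"
      "flat_algebra (\<lambda>x. f' x (axis i 1))"
      using flat_algebra_has_derivative[OF Cons] by blast
    have "partials (i # is) f = (\<lambda>x. f' x (axis i 1))"
      by (rule ext) (simp add: partial_eq[OF f'(1)])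
    then show ?case using f'(2) by simp
  qed (simp add: assms)
  then show ?thesis
    unfolding smooth_def differentiable_def using flat_algebra_has_derivative by blast
qed

text \<open>Every factor is \<open>exp (- 1 / ((n + 1) s))\<close> with \<open>s\<close> the distance of \<open>x\<close> to a face of the
  box, as long as \<open>x\<close> lies on the inner side of that face; it tends to \<open>1\<close> as \<open>n\<close> grows, whereas
  the support is the same for all \<open>n\<close>.\<close>

definition box_bump :: "nat \<Rightarrow> real^'d \<Rightarrow> real^'d \<Rightarrow> real^'d \<Rightarrow> real" where
  "box_bump n a b x =
     (\<Prod>i\<in>UNIV. flat 0 (real (Suc n) * (x $ i - a $ i)) * flat 0 (real (Suc n) * (b $ i - x $ i)))"


lemma flat_0_bounds: "0 \<le> flat 0 t" "flat 0 t \<le> 1" "flat 0 t \<noteq> 0 \<longleftrightarrow> 0 < t"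
  by (auto simp: flat_def)

lemma flat_0_tendsto_1:
  assumes "0 < t"
  shows "(\<lambda>n. flat 0 (real (Suc n) * t)) \<longlonglongrightarrow> 1"
proof -
  have "(\<lambda>n. exp (- (inverse (real (Suc n)) * inverse t))) \<longlonglongrightarrow> exp (- (0 * inverse t))"
    by (intro tendsto_intros LIMSEQ_inverse_real_of_nat)
  moreover have "exp (- (inverse (real (Suc n)) * inverse t)) = flat 0 (real (Suc n) * t)" for n
  proof -
    have "0 < real (Suc n) * t" using assms by simp
    then show ?thesis by (simp add: flat_def inverse_eq_divide del: of_nat_Suc)
  qed
  ultimately show ?thesis by simp
qed

lemma box_bump_smooth: "smooth (box_bump n a b :: real^'d \<Rightarrow> real)"
proof (rule flat_algebra_smooth)
  have "flat_algebra (\<lambda>x :: real^'d. flat 0 (real (Suc n) * x $ i + (- (real (Suc n) * a $ i))) *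
      flat 0 ((- real (Suc n)) * x $ i + real (Suc n) * b $ i))" for i
    by (intro flat_algebra.intros)
  then show "flat_algebra (box_bump n a b :: real^'d \<Rightarrow> real)"
    unfolding box_bump_def[abs_def]
    by (intro flat_algebra_prod) (simp add: algebra_simps)
qed

lemma box_bump_bounds: "0 \<le> box_bump n a b x" "box_bump n a b x \<le> 1"
  unfolding box_bump_def
  by (intro prod_nonneg prod_le_1 ballI conjI mult_nonneg_nonneg mult_le_one flat_0_bounds)+

lemma box_bump_support: "box_bump n a b x \<noteq> 0 \<longleftrightarrow> x \<in> box a b"
proof -
  have "flat 0 (real (Suc n) * t) \<noteq> 0 \<longleftrightarrow> 0 < t" for t
    by (simp add: flat_0_bounds(3) zero_less_mult_iff del: of_nat_Suc)
  then show ?thesis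
    by (auto simp: box_bump_def mem_box_cart simp del: of_nat_Suc)
qed

lemma box_bump_tendsto: "(\<lambda>n. box_bump n a b x) \<longlonglongrightarrow> indicator (box a b) x"
proof (cases "x \<in> box a b")
  case True
  have "(\<lambda>n. \<Prod>i\<in>UNIV. flat 0 (real (Suc n) * (x $ i - a $ i)) * flat 0 (real (Suc n) * (b $ i - x $ i)))
      \<longlonglongrightarrow> (\<Prod>i\<in>(UNIV :: 'a set). 1 * 1)"
    using True by (intro tendsto_intros flat_0_tendsto_1) (auto simp: mem_box_cart)
  then show ?thesis using True by (simp add: box_bump_def)
next
  case False
  then have "box_bump n a b x = 0" for n
    using box_bump_support by blast
  then show ?thesis using False by simp
qed

lemma box_bump_test_fun:
  fixes \<Omega> :: "(real^'d) set"
  assumes "cbox a b \<subseteq> \<Omega>" "box c d \<subseteq> box a b"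
  shows "test_fun \<Omega> (box_bump n c d)"
proof -
  have "{x. box_bump n c d x \<noteq> 0} = box c d"
    by (simp add: box_bump_support)
  moreover have "closure (box c d) \<subseteq> cbox a b"
    using assms(2) box_subset_cbox[of a b] by (intro closure_minimal) auto
  moreover have "compact (closure (box c d))"
    by (simp add: compact_closure)
  ultimately show ?thesis
    using assms(1) by (auto simp: test_fun_def box_bump_smooth)
qed


section \<open>The fundamental lemma of the calculus of variations\<close>

text \<open>The Borel sets over which \<open>F\<close> has integral zero form a Dynkin system, so it suffices that
  they contain the intersection-stable generator given by the boxes. Applied to the sets where \<open>F\<close> is
  positive and where it is negative, this shows that both parts of \<open>F\<close> vanish. The condition on the
  total integral is what closure under complements needs.\<close>

lemma AE_eq_0_if_integral_box_eq_0:
  fixes F :: "'a::euclidean_space \<Rightarrow> real"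
  assumes int: "integrable lborel F" and total: "(\<integral>x. F x \<partial>lborel) = 0"
    and box: "\<And>a b. (\<integral>x. indicator (box a b) x * F x \<partial>lborel) = 0"
  shows "AE x in lborel. F x = 0"
proof -
  have F[measurable]: "F \<in> borel_measurable borel"
    using borel_measurable_integrable[OF int] by simp
  have int_ind: "integrable lborel (\<lambda>x. indicator A x * F x)" if "A \<in> sets borel" for A
    using integrable_mult_indicator[OF _ int, of A] that by simp
  let ?G = "range (\<lambda>(a, b). box a b :: 'a set)"
  have borel: "sets borel = sigma_sets UNIV ?G"
    unfolding borel_eq_box by (rule sets_measure_of) simp
  have zero: "(\<integral>x. indicator A x * F x \<partial>lborel) = 0" if "A \<in> sets borel" for A
  proof -
    have stable: "Int_stable ?G"
    proof (rule Int_stableI)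
      fix A B assume "A \<in> ?G" "B \<in> ?G"
      then obtain a b c d where AB: "A = box a b" "B = box c d" by auto
      show "A \<inter> B \<in> ?G"
        unfolding AB box_Int_box by (rule range_eqI[of _ _ "(_, _)"]) simp
    qed
    have A: "?G \<subseteq> Pow UNIV" "A \<in> sigma_sets UNIV ?G"
      using that by (simp_all add: borel)
    from stable A show ?thesis
    proof (induction rule: sigma_sets_induct_disjoint)
      case (compl A)
      have "(\<integral>x. indicator (UNIV - A) x * F x \<partial>lborel) = (\<integral>x. F x - indicator A x * F x \<partial>lborel)"
        by (rule Bochner_Integration.integral_cong) (auto simp: indicator_def)
      then show ?case
        using compl int int_ind[of A] total by (simp add: borel)
    next
      case (union A)
      then have "A i \<in> sets lborel" for i
        by (auto simp: borel)
      moreover from this have "set_integrable lborel (\<Union>i. A i) F"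
        unfolding set_integrable_def using int by (intro integrable_mult_indicator) auto
      ultimately have "(LINT x:(\<Union>i. A i)|lborel. F x) = (\<Sum>i. (LINT x:(A i)|lborel. F x))"
        using union(1) by (intro lebesgue_integral_countable_add) (auto simp: disjoint_family_on_def)
      then show ?case
        using union(3) by (simp add: set_lebesgue_integral_def)
    qed (auto simp: box)
  qed
  let ?P = "{x. 0 < F x}" and ?N = "{x. F x < 0}"
  have P: "?P \<in> sets borel" and N: "?N \<in> sets borel"
    by measurable
  have "AE x in lborel. indicator ?P x * F x = 0"
    using zero[OF P] int_ind[OF P]
    by (subst (asm) integral_nonneg_eq_0_iff_AE) (auto simp: indicator_def)
  moreover have "(\<integral>x. - (indicator ?N x * F x) \<partial>lborel) = 0"
    using zero[OF N] by simp
  then have "AE x in lborel. - (indicator ?N x * F x) = 0"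
    using int_ind[OF N]
    by (subst (asm) integral_nonneg_eq_0_iff_AE) (auto simp: indicator_def)
  ultimately show ?thesis
    by eventually_elim (auto simp: indicator_def split: if_splits)
qed

text \<open>The bumps on a box inside \<open>\<Omega>\<close> converge boundedly to its indicator function, so \<open>g\<close> has
  integral zero over all such boxes and vanishes almost everywhere on each of them; countably many of
  them cover \<open>\<Omega>\<close> up to a null set. The argument over Borel sets is carried out for \<open>G'\<close>, a Borel
  function that agrees almost everywhere with the extension of \<open>g\<close> by zero.\<close>

lemma ae_eq_0_if_orthogonal_to_test_funs:
  fixes \<Omega> :: "(real^'d) set"
  assumes "open \<Omega>" "g \<in> L2 \<Omega>" and orth: "\<And>\<phi>. test_fun \<Omega> \<phi> \<Longrightarrow> l2_inner \<Omega> g \<phi> = 0"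
  shows "ae_eq \<Omega> g (\<lambda>_. 0)"
proof -
  have \<Omega>: "\<Omega> \<inter> space lebesgue \<in> sets lebesgue"
    using assms(1) by simp
  let ?G = "\<lambda>x. indicator \<Omega> x * g x"
  have G: "?G \<in> borel_measurable lebesgue"
    using L2D(1)[OF assms(2)] borel_measurable_restrict_space_iff[OF \<Omega>, of g] by simp
  then obtain G' where G'[measurable]: "G' \<in> borel_measurable lborel"
    and GG': "AE x in lborel. ?G x = G' x"
    using completion_ex_borel_measurable_real by blast
  then have GG'_leb: "AE x in lebesgue. ?G x = G' x"
    by (simp add: AE_completion_iff)
  have "integrable lebesgue (\<lambda>x. indicator \<Omega> x *\<^sub>R (g x)\<^sup>2)"
    using L2D(2)[OF assms(2)] integrable_restrict_space[OF \<Omega>, of "\<lambda>x. (g x)\<^sup>2"] by simp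
  then have "integrable lebesgue (\<lambda>x. (G' x)\<^sup>2)"
  proof (rule integrable_cong_AE_imp)
    show "(\<lambda>x. (G' x)\<^sup>2) \<in> borel_measurable lebesgue"
      using G' by (intro borel_measurable_power measurable_completion)
    show "AE x in lebesgue. indicator \<Omega> x *\<^sub>R (g x)\<^sup>2 = (G' x)\<^sup>2"
      using GG'_leb by eventually_elim (auto simp: indicator_def split: if_splits)
  qed
  then have G'_sq: "integrable lborel (\<lambda>x. (G' x)\<^sup>2)"
    by (subst (asm) integrable_completion) auto
  \<comment> \<open>\<open>G'\<close> is square integrable, hence integrable on sets of finite measure.\<close>
  have int_box: "integrable lborel (\<lambda>x. indicator (box a b) x * G' x)" for a b
  proof (rule Bochner_Integration.integrable_bound)
    show "integrable lborel (\<lambda>x. indicator (box a b) x + (G' x)\<^sup>2)"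
      using G'_sq by (intro Bochner_Integration.integrable_add integrable_real_indicator
          emeasure_bounded_finite) auto
    have "\<bar>t\<bar> \<le> 1 + t\<^sup>2" for t :: real
      using sum_squares_bound[of 1 "\<bar>t\<bar>"] unfolding power2_abs by simp
    then show "AE x in lborel. norm (indicator (box a b) x * G' x)
        \<le> norm (indicator (box a b) x + (G' x)\<^sup>2)"
      by (intro AE_I2) (auto simp: indicator_def)
  qed measurable
  have zero: "(\<integral>x. indicator (box c d) x * G' x \<partial>lborel) = 0"
    if "cbox a b \<subseteq> \<Omega>" "box c d \<subseteq> box a b" for a b c d
  proof -
    have bump[measurable]: "box_bump n c d \<in> borel_measurable borel" for n
      by (intro smooth_borel box_bump_smooth)
    have "(\<integral>x. box_bump n c d x * G' x \<partial>lborel) = 0" for n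
    proof -
      have "(\<integral>x. box_bump n c d x * G' x \<partial>lborel) = (\<integral>x. box_bump n c d x * G' x \<partial>lebesgue)"
        by (rule integral_completion[symmetric]) measurable
      also have "\<dots> = (\<integral>x. indicator \<Omega> x *\<^sub>R (g x \<bullet> box_bump n c d x) \<partial>lebesgue)"
      proof (rule integral_cong_AE)
        show "(\<lambda>x. box_bump n c d x * G' x) \<in> borel_measurable lebesgue"
          by (intro measurable_completion) measurable
        have "(\<lambda>x. ?G x * box_bump n c d x) \<in> borel_measurable lebesgue"
          using bump[of n] by (intro borel_measurable_times G measurable_completion) simp
        then show "(\<lambda>x. indicator \<Omega> x *\<^sub>R (g x \<bullet> box_bump n c d x)) \<in> borel_measurable lebesgue"
          by (simp add: mult.assoc)
        show "AE x in lebesgue. box_bump n c d x * G' x = indicator \<Omega> x *\<^sub>R (g x \<bullet> box_bump n c d x)"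
          using GG'_leb by eventually_elim auto
      qed
      also have "\<dots> = l2_inner \<Omega> g (box_bump n c d)"
        unfolding l2_inner_def by (rule integral_restrict_space[OF \<Omega>, symmetric])
      also have "\<dots> = 0"
        by (rule orth[OF box_bump_test_fun[OF that]])
      finally show ?thesis .
    qed
    moreover have "(\<lambda>n. \<integral>x. box_bump n c d x * G' x \<partial>lborel)
        \<longlonglongrightarrow> (\<integral>x. indicator (box c d) x * G' x \<partial>lborel)"
    proof (rule integral_dominated_convergence[where w = "\<lambda>x. \<bar>indicator (box c d) x * G' x\<bar>"])
      show "AE x in lborel. (\<lambda>n. box_bump n c d x * G' x) \<longlonglongrightarrow> indicator (box c d) x * G' x"
        by (intro AE_I2 tendsto_mult box_bump_tendsto tendsto_const)
      show "AE x in lborel. norm (box_bump n c d x * G' x) \<le> \<bar>indicator (box c d) x * G' x\<bar>" for n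
      proof (rule AE_I2)
        fix x
        have "\<bar>box_bump n c d x\<bar> \<le> indicator (box c d) x"
          using box_bump_bounds[of n c d x] box_bump_support[of n c d x]
          by (auto simp: indicator_def)
        then show "norm (box_bump n c d x * G' x) \<le> \<bar>indicator (box c d) x * G' x\<bar>"
          by (auto simp: abs_mult intro!: mult_right_mono)
      qed
    qed (use int_box in \<open>auto simp: G'\<close>)
    ultimately show ?thesis by (simp add: LIMSEQ_const_iff)
  qed
  have box_null: "AE x in lborel. x \<in> box a b \<longrightarrow> G' x = 0" if "cbox a b \<subseteq> \<Omega>" for a b
  proof -
    have "AE x in lborel. indicator (box a b) x * G' x = 0"
    proof (rule AE_eq_0_if_integral_box_eq_0[OF int_box zero[OF that subset_refl]])
      fix c d :: "real^'d"
      obtain p q where pq: "box c d \<inter> box a b = box p q"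
        unfolding box_Int_box by blast
      have "(\<integral>x. indicator (box p q) x * G' x \<partial>lborel) = 0"
        using pq by (intro zero[OF that]) auto
      then show "(\<integral>x. indicator (box c d) x * (indicator (box a b) x * G' x) \<partial>lborel) = 0"
        by (simp add: pq[symmetric] indicator_inter_arith mult.assoc)
    qed
    then show ?thesis by eventually_elim (auto simp: indicator_def)
  qed
  obtain \<D> where \<D>: "countable \<D>" "\<D> \<subseteq> Pow \<Omega>" "\<And>X. X \<in> \<D> \<Longrightarrow> \<exists>a b. X = cbox a b" "\<Union>\<D> = \<Omega>"
    using open_countable_Union_open_cbox[OF assms(1)] by metis
  \<comment> \<open>The cover consists of closed boxes, which differ from the open ones by null sets.\<close>
  have "AE x in lebesgue. x \<in> X \<longrightarrow> ?G x = 0" if X: "X \<in> \<D>" for X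
  proof -
    obtain a b where ab: "X = cbox a b" "cbox a b \<subseteq> \<Omega>"
      using \<D>(2,3) X by blast
    have "AE x in lebesgue. x \<notin> cbox a b - box a b"
      using negligible_frontier_interval[of a b] by (intro AE_not_in) (simp add: negligible_iff_null_sets)
    moreover have "AE x in lebesgue. x \<in> box a b \<longrightarrow> G' x = 0"
      using box_null[OF ab(2)] by (simp add: AE_completion_iff)
    ultimately show ?thesis
      using GG'_leb unfolding ab(1) by eventually_elim auto
  qed
  then have "AE x in lebesgue. \<forall>X\<in>\<D>. x \<in> X \<longrightarrow> ?G x = 0"
    by (intro iffD2[OF AE_ball_countable[OF \<D>(1)]]) blast
  then have "AE x in lebesgue. x \<in> \<Omega> \<longrightarrow> g x = 0"
  proof eventually_elim
    case (elim x)
    show ?case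
    proof
      assume x: "x \<in> \<Omega>"
      then obtain X where "X \<in> \<D>" "x \<in> X"
        using \<D>(4) by blast
      with elim x show "g x = 0" by auto
    qed
  qed
  then show ?thesis
    unfolding ae_eq_def by (simp add: AE_restrict_space_iff[OF \<Omega>])
qed


section \<open>Weak derivatives and Sobolev spaces\<close>

lemma ae_eq_sym: "ae_eq \<Omega> u v \<Longrightarrow> ae_eq \<Omega> v u"
  by (simp add: ae_eq_def eq_commute)

lemma ae_eq_refl [simp]: "ae_eq \<Omega> u u"
  by (simp add: ae_eq_def)

lemma has_weak_deriv_unique:
  fixes \<Omega> :: "(real^'d) set"
  assumes "open \<Omega>" "g \<in> L2 \<Omega>" "h \<in> L2 \<Omega>" "has_weak_deriv \<Omega> is u g" "has_weak_deriv \<Omega> is u h"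
  shows "ae_eq \<Omega> g h"
proof -
  have "ae_eq \<Omega> (\<lambda>x. g x - h x) (\<lambda>_. 0)"
  proof (rule ae_eq_0_if_orthogonal_to_test_funs[OF assms(1) L2_diff[OF assms(2,3)]])
    fix \<phi> assume \<phi>: "test_fun \<Omega> \<phi>"
    then have "(-1) ^ length is * l2_inner \<Omega> g \<phi> = (-1) ^ length is * l2_inner \<Omega> h \<phi>"
      using assms(4,5) unfolding has_weak_deriv_def by metis
    then show "l2_inner \<Omega> (\<lambda>x. g x - h x) \<phi> = 0"
      using l2_inner_diff[OF assms(2,3) test_fun_in_L2[OF assms(1) \<phi>]] by simp
  qed
  then show ?thesis
    unfolding ae_eq_def by eventually_elim simp
qed

lemma sobolev_L2: "u \<in> sobolev m \<Omega> \<Longrightarrow> u \<in> L2 \<Omega>"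
  by (simp add: sobolev_def)

lemma sobolev0_sobolev: "u \<in> sobolev0 m \<Omega> \<Longrightarrow> u \<in> sobolev m \<Omega>"
  by (simp add: sobolev0_def)

lemma
  assumes "g \<in> L2 \<Omega>" "has_weak_deriv \<Omega> is u g"
  shows weak_deriv_L2_if: "weak_deriv \<Omega> is u \<in> L2 \<Omega>"
    and has_weak_deriv_weak_deriv_if: "has_weak_deriv \<Omega> is u (weak_deriv \<Omega> is u)"
proof -
  have "\<exists>g. g \<in> L2 \<Omega> \<and> has_weak_deriv \<Omega> is u g"
    using assms by blast
  from someI_ex[OF this]
  show "weak_deriv \<Omega> is u \<in> L2 \<Omega>" "has_weak_deriv \<Omega> is u (weak_deriv \<Omega> is u)"
    unfolding weak_deriv_def by simp_all
qed

lemma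
  assumes "u \<in> sobolev m \<Omega>" "length is \<le> m"
  shows weak_deriv_L2: "weak_deriv \<Omega> is u \<in> L2 \<Omega>"
    and has_weak_deriv_weak_deriv: "has_weak_deriv \<Omega> is u (weak_deriv \<Omega> is u)"
proof -
  obtain g where "g \<in> L2 \<Omega>" "has_weak_deriv \<Omega> is u g"
    using assms unfolding sobolev_def by blast
  then show "weak_deriv \<Omega> is u \<in> L2 \<Omega>" "has_weak_deriv \<Omega> is u (weak_deriv \<Omega> is u)"
    by (rule weak_deriv_L2_if, rule has_weak_deriv_weak_deriv_if)
qed

text \<open>Uniqueness makes the choice in \<open>weak_deriv\<close> immaterial: any weak derivative found in \<open>L\<^sup>2\<close>
  may be computed with instead.\<close>

lemma weak_deriv_ae_eq:
  fixes \<Omega> :: "(real^'d) set"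
  assumes "open \<Omega>" "g \<in> L2 \<Omega>" "has_weak_deriv \<Omega> is u g"
  shows "ae_eq \<Omega> (weak_deriv \<Omega> is u) g"
  by (rule has_weak_deriv_unique[OF assms(1) weak_deriv_L2_if[OF assms(2,3)] assms(2)
        has_weak_deriv_weak_deriv_if[OF assms(2,3)] assms(3)])

lemma has_weak_deriv_Nil: "has_weak_deriv \<Omega> [] u u"
  by (simp add: has_weak_deriv_def)

lemma has_weak_deriv_test_fun:
  fixes \<Omega> :: "(real^'d) set"
  assumes "open \<Omega>" "test_fun \<Omega> \<phi>"
  shows "has_weak_deriv \<Omega> is \<phi> (partials (rev is) \<phi>)"
  using l2_inner_partials[OF assms] by (simp add: has_weak_deriv_def)

lemma weak_deriv_test_fun:
  fixes \<Omega> :: "(real^'d) set"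
  assumes "open \<Omega>" "test_fun \<Omega> \<phi>"
  shows "ae_eq \<Omega> (weak_deriv \<Omega> is \<phi>) (partials (rev is) \<phi>)"
  using weak_deriv_ae_eq[OF assms(1) test_fun_in_L2[OF assms(1) test_fun_partials[OF assms(2)]]
      has_weak_deriv_test_fun[OF assms]] .

lemma test_fun_sobolev:
  fixes \<Omega> :: "(real^'d) set"
  assumes "open \<Omega>" "test_fun \<Omega> \<phi>"
  shows "\<phi> \<in> sobolev m \<Omega>"
  unfolding sobolev_def
  using test_fun_in_L2[OF assms(1)] test_fun_partials[OF assms(2)] assms(2)
    has_weak_deriv_test_fun[OF assms] by blast

lemma has_weak_deriv_diff:
  fixes \<Omega> :: "(real^'d) set"
  assumes "open \<Omega>" "u \<in> L2 \<Omega>" "v \<in> L2 \<Omega>" "g \<in> L2 \<Omega>" "h \<in> L2 \<Omega>"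
    "has_weak_deriv \<Omega> is u g" "has_weak_deriv \<Omega> is v h"
  shows "has_weak_deriv \<Omega> is (\<lambda>x. u x - v x) (\<lambda>x. g x - h x)"
  unfolding has_weak_deriv_def
proof (intro allI impI)
  fix \<phi> assume \<phi>: "test_fun \<Omega> \<phi>"
  have "\<phi> \<in> L2 \<Omega>" "partials is \<phi> \<in> L2 \<Omega>"
    using \<phi> by (simp_all add: test_fun_in_L2[OF assms(1)] test_fun_partials)
  then show "l2_inner \<Omega> (\<lambda>x. u x - v x) (partials is \<phi>)
      = (-1) ^ length is * l2_inner \<Omega> (\<lambda>x. g x - h x) \<phi>"
    using assms(6,7) \<phi> unfolding has_weak_deriv_def
    by (simp add: l2_inner_diff assms(2-5) right_diff_distrib)
qed

lemma sobolev_diff: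
  fixes \<Omega> :: "(real^'d) set"
  assumes "open \<Omega>" "u \<in> sobolev m \<Omega>" "v \<in> sobolev m \<Omega>"
  shows "(\<lambda>x. u x - v x) \<in> sobolev m \<Omega>"
  unfolding sobolev_def
proof (intro CollectI conjI allI impI)
  show "(\<lambda>x. u x - v x) \<in> L2 \<Omega>"
    by (intro L2_diff sobolev_L2[OF assms(2)] sobolev_L2[OF assms(3)])
  fix "is" :: "'d list" assume len: "length is \<le> m"
  note u = weak_deriv_L2[OF assms(2) len] has_weak_deriv_weak_deriv[OF assms(2) len]
  note v = weak_deriv_L2[OF assms(3) len] has_weak_deriv_weak_deriv[OF assms(3) len]
  show "\<exists>g\<in>L2 \<Omega>. has_weak_deriv \<Omega> is (\<lambda>x. u x - v x) g"
    using has_weak_deriv_diff[OF assms(1) sobolev_L2[OF assms(2)] sobolev_L2[OF assms(3)]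
        u(1) v(1) u(2) v(2)] L2_diff[OF u(1) v(1)] by blast
qed

lemma weak_deriv_diff:
  fixes \<Omega> :: "(real^'d) set"
  assumes "open \<Omega>" "u \<in> sobolev m \<Omega>" "v \<in> sobolev m \<Omega>" "length is \<le> m"
  shows "ae_eq \<Omega> (weak_deriv \<Omega> is (\<lambda>x. u x - v x)) (\<lambda>x. weak_deriv \<Omega> is u x - weak_deriv \<Omega> is v x)"
proof -
  note u = weak_deriv_L2[OF assms(2,4)] has_weak_deriv_weak_deriv[OF assms(2,4)]
  note v = weak_deriv_L2[OF assms(3,4)] has_weak_deriv_weak_deriv[OF assms(3,4)]
  show ?thesis
    by (rule weak_deriv_ae_eq[OF assms(1) L2_diff[OF u(1) v(1)]
          has_weak_deriv_diff[OF assms(1) sobolev_L2[OF assms(2)] sobolev_L2[OF assms(3)]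
            u(1) v(1) u(2) v(2)]])
qed

lemma l2_norm_weak_deriv_le_sobolev_norm:
  fixes v :: "real^'d \<Rightarrow> real"
  assumes "length is \<le> m"
  shows "sqrt (l2_inner \<Omega> (weak_deriv \<Omega> is v) (weak_deriv \<Omega> is v)) \<le> sobolev_norm m \<Omega> v"
proof -
  have "finite {is :: 'd list. length is \<le> m}"
    using finite_lists_length_le[of "UNIV :: 'd set" m] by simp
  then show ?thesis
    unfolding sobolev_norm_def using assms
    by (intro real_sqrt_le_mono member_le_sum) (auto simp: l2_inner_self_nonneg)
qed

text \<open>Weak derivatives are linear up to null sets, so the difference of the two inner products is
  bounded, by the Cauchy-Schwarz inequality, by a multiple of the Sobolev norm of \<open>\<phi> n - v\<close>.\<close>

lemma l2_inner_weak_deriv_tendsto: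
  fixes \<Omega> :: "(real^'d) set"
  assumes "open \<Omega>" "v \<in> sobolev m \<Omega>" "\<And>n. \<phi> n \<in> sobolev m \<Omega>"
    and lim: "(\<lambda>n. sobolev_norm m \<Omega> (\<lambda>x. \<phi> n x - v x)) \<longlonglongrightarrow> 0"
    and "length is \<le> m" "h \<in> L2 \<Omega>"
  shows "(\<lambda>n. l2_inner \<Omega> h (weak_deriv \<Omega> is (\<phi> n))) \<longlonglongrightarrow> l2_inner \<Omega> h (weak_deriv \<Omega> is v)"
proof -
  let ?d = "\<lambda>n x. \<phi> n x - v x"
  have bound: "\<bar>l2_inner \<Omega> h (weak_deriv \<Omega> is (\<phi> n)) - l2_inner \<Omega> h (weak_deriv \<Omega> is v)\<bar>
      \<le> sqrt (l2_inner \<Omega> h h) * sobolev_norm m \<Omega> (?d n)" for n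
  proof -
    note L2s = weak_deriv_L2[OF assms(3)[of n] assms(5)] weak_deriv_L2[OF assms(2,5)]
      weak_deriv_L2[OF sobolev_diff[OF assms(1) assms(3)[of n] assms(2)] assms(5)]
    have "l2_inner \<Omega> h (weak_deriv \<Omega> is (\<phi> n)) - l2_inner \<Omega> h (weak_deriv \<Omega> is v)
        = l2_inner \<Omega> h (\<lambda>x. weak_deriv \<Omega> is (\<phi> n) x - weak_deriv \<Omega> is v x)"
      using l2_inner_diff[OF L2s(1,2) assms(6)] by (simp add: l2_inner_commute[of \<Omega> h])
    also have "\<dots> = l2_inner \<Omega> h (weak_deriv \<Omega> is (?d n))"
      using ae_eq_sym[OF weak_deriv_diff[OF assms(1) assms(3)[of n] assms(2,5)]] L2s assms(6)
      by (intro l2_inner_cong_AE) auto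
    also have "\<bar>\<dots>\<bar> \<le> sqrt (l2_inner \<Omega> h h) *
        sqrt (l2_inner \<Omega> (weak_deriv \<Omega> is (?d n)) (weak_deriv \<Omega> is (?d n)))"
      by (rule l2_cauchy_schwarz[OF assms(6) L2s(3)])
    also have "\<dots> \<le> sqrt (l2_inner \<Omega> h h) * sobolev_norm m \<Omega> (?d n)"
      by (intro mult_left_mono l2_norm_weak_deriv_le_sobolev_norm assms)
        (simp add: l2_inner_self_nonneg)
    finally show ?thesis .
  qed
  have "(\<lambda>n. sqrt (l2_inner \<Omega> h h) * sobolev_norm m \<Omega> (?d n)) \<longlonglongrightarrow> 0"
    using tendsto_mult_right_zero[OF lim] .
  then have "(\<lambda>n. l2_inner \<Omega> h (weak_deriv \<Omega> is (\<phi> n)) - l2_inner \<Omega> h (weak_deriv \<Omega> is v)) \<longlonglongrightarrow> 0"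
    by (rule Lim_null_comparison[rotated]) (simp only: real_norm_def bound eventually_True)
  then show ?thesis by (rule LIM_zero_cancel)
qed

lemma sobolev_norm_zero:
  fixes \<Omega> :: "(real^'d) set"
  assumes "open \<Omega>"
  shows "sobolev_norm m \<Omega> (\<lambda>_. 0) = 0"
proof -
  have "l2_inner \<Omega> (weak_deriv \<Omega> is (\<lambda>_. 0)) (weak_deriv \<Omega> is (\<lambda>_. 0)) = 0" for "is" :: "'d list"
  proof -
    have "has_weak_deriv \<Omega> is (\<lambda>_. 0) (\<lambda>_. 0)"
      by (simp add: has_weak_deriv_def l2_inner_def)
    note * = weak_deriv_ae_eq[OF assms L2_zero this] weak_deriv_L2_if[OF L2_zero this]
    have "l2_inner \<Omega> (weak_deriv \<Omega> is (\<lambda>_. 0)) (weak_deriv \<Omega> is (\<lambda>_. 0))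
        = l2_inner \<Omega> (\<lambda>_. 0) (\<lambda>_. 0 :: real)"
      by (intro l2_inner_cong_AE * L2_zero)
    then show ?thesis by (simp add: l2_inner_def)
  qed
  then show ?thesis by (simp add: sobolev_norm_def)
qed

lemma test_fun_sobolev0:
  fixes \<Omega> :: "(real^'d) set"
  assumes "open \<Omega>" "test_fun \<Omega> \<phi>"
  shows "\<phi> \<in> sobolev0 m \<Omega>"
  unfolding sobolev0_def
  using test_fun_sobolev[OF assms] assms(2) sobolev_norm_zero[OF assms(1)]
  by (auto intro!: exI[of _ "\<lambda>_. \<phi>"])

text \<open>The two predicates are equal, not merely equivalent up to null sets, because \<open>u\<close> and \<open>v\<close>
  enter only through integrals; consequently \<open>weak_deriv\<close> makes the same choice for both.\<close>

lemma has_weak_deriv_cong: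
  fixes \<Omega> :: "(real^'d) set"
  assumes "open \<Omega>" "ae_eq \<Omega> u v" "u \<in> L2 \<Omega>" "v \<in> L2 \<Omega>"
  shows "has_weak_deriv \<Omega> is u = has_weak_deriv \<Omega> is v"
proof -
  have "l2_inner \<Omega> u (partials is \<phi>) = l2_inner \<Omega> v (partials is \<phi>)" if "test_fun \<Omega> \<phi>" for \<phi>
    using assms test_fun_in_L2[OF assms(1) test_fun_partials[OF that]]
    by (intro l2_inner_cong_AE) auto
  then show ?thesis
    by (auto simp: has_weak_deriv_def fun_eq_iff)
qed

lemma sobolev0_cong:
  fixes \<Omega> :: "(real^'d) set"
  assumes "open \<Omega>" "ae_eq \<Omega> u v" "v \<in> L2 \<Omega>" "u \<in> sobolev0 m \<Omega>"
  shows "v \<in> sobolev0 m \<Omega>"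
proof -
  note u = sobolev0_sobolev[OF assms(4)] sobolev_L2[OF sobolev0_sobolev[OF assms(4)]]
  obtain \<phi> where \<phi>: "\<And>n. test_fun \<Omega> (\<phi> n)" "(\<lambda>n. sobolev_norm m \<Omega> (\<lambda>x. \<phi> n x - u x)) \<longlonglongrightarrow> 0"
    using assms(4) by (auto simp: sobolev0_def)
  have "sobolev_norm m \<Omega> (\<lambda>x. \<phi> n x - u x) = sobolev_norm m \<Omega> (\<lambda>x. \<phi> n x - v x)" for n
  proof -
    have "\<phi> n \<in> L2 \<Omega>" by (rule test_fun_in_L2[OF assms(1) \<phi>(1)])
    then have L2s: "(\<lambda>x. \<phi> n x - u x) \<in> L2 \<Omega>" "(\<lambda>x. \<phi> n x - v x) \<in> L2 \<Omega>"
      using u(2) assms(3) by (auto intro: L2_diff)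
    have "ae_eq \<Omega> (\<lambda>x. \<phi> n x - u x) (\<lambda>x. \<phi> n x - v x)"
      using assms(2) unfolding ae_eq_def by eventually_elim simp
    from has_weak_deriv_cong[OF assms(1) this L2s] show ?thesis
      by (simp add: sobolev_norm_def weak_deriv_def)
  qed
  moreover have "v \<in> sobolev m \<Omega>"
    using u(1) assms(3) has_weak_deriv_cong[OF assms(1,2) u(2) assms(3)]
    by (simp add: sobolev_def)
  ultimately show ?thesis
    using \<phi> by (auto simp: sobolev0_def)
qed


section \<open>The primal and the mixed problem\<close>

lemma laplacian_L2: "u \<in> sobolev 2 \<Omega> \<Longrightarrow> laplacian \<Omega> u \<in> L2 \<Omega>"
  unfolding laplacian_def by (intro L2_sum weak_deriv_L2) auto

lemma l2_inner_laplacian: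
  fixes \<Omega> :: "(real^'d) set"
  assumes "v \<in> sobolev 2 \<Omega>" "h \<in> L2 \<Omega>"
  shows "l2_inner \<Omega> h (laplacian \<Omega> v) = (\<Sum>i\<in>UNIV. l2_inner \<Omega> h (weak_deriv \<Omega> [i, i] v))"
  unfolding laplacian_def l2_inner_commute[of \<Omega> h]
  using assms by (intro l2_inner_sum weak_deriv_L2[OF assms(1)]) auto

text \<open>The weak second derivatives are tested against \<open>\<zeta>\<close>, and the weak first derivatives
  against \<open>\<partial>\<^sub>j\<zeta>\<close>; both give \<open>(u, \<partial>\<^sub>j\<partial>\<^sub>j\<zeta>)\<close> up to sign.\<close>

lemma l2_inner_laplacian_test_fun:
  fixes \<Omega> :: "(real^'d) set"
  assumes "open \<Omega>" "u \<in> sobolev 2 \<Omega>" "test_fun \<Omega> \<zeta>"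
  shows "l2_inner \<Omega> (laplacian \<Omega> u) \<zeta> = - l2_inner \<Omega> (grad \<Omega> u) (grad \<Omega> \<zeta>)"
proof -
  note \<zeta> = test_fun_in_L2[OF assms(1,3)]
  have first: "weak_deriv \<Omega> [j] u \<in> L2 \<Omega>" "weak_deriv \<Omega> [j] \<zeta> \<in> L2 \<Omega>" for j
    using assms(2) test_fun_sobolev[OF assms(1,3), of 2] by (auto intro: weak_deriv_L2)
  have j: "l2_inner \<Omega> (weak_deriv \<Omega> [j, j] u) \<zeta> = - l2_inner \<Omega> (weak_deriv \<Omega> [j] u) (weak_deriv \<Omega> [j] \<zeta>)" for j
  proof -
    have "l2_inner \<Omega> (weak_deriv \<Omega> [j, j] u) \<zeta> = l2_inner \<Omega> u (partials [j] (partial j \<zeta>))"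
      using has_weak_deriv_weak_deriv[OF assms(2), of "[j, j]"] assms(3)
      by (simp add: has_weak_deriv_def)
    also have "\<dots> = - l2_inner \<Omega> (weak_deriv \<Omega> [j] u) (partial j \<zeta>)"
      using has_weak_deriv_weak_deriv[OF assms(2), of "[j]"] test_fun_partial[OF assms(3)]
      unfolding has_weak_deriv_def by fastforce
    also have "l2_inner \<Omega> (weak_deriv \<Omega> [j] u) (partial j \<zeta>)
        = l2_inner \<Omega> (weak_deriv \<Omega> [j] u) (weak_deriv \<Omega> [j] \<zeta>)"
      using weak_deriv_test_fun[OF assms(1,3), of "[j]"] first
        test_fun_in_L2[OF assms(1) test_fun_partial[OF assms(3)]]
      by (intro l2_inner_cong_AE) (auto intro: ae_eq_sym)
    finally show ?thesis .
  qed
  have "l2_inner \<Omega> (laplacian \<Omega> u) \<zeta> = (\<Sum>j\<in>UNIV. l2_inner \<Omega> (weak_deriv \<Omega> [j, j] u) \<zeta>)"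
    using l2_inner_laplacian[OF assms(2) \<zeta>] by (simp only: l2_inner_commute[of \<Omega> \<zeta>])
  also have "\<dots> = - l2_inner \<Omega> (grad \<Omega> u) (grad \<Omega> \<zeta>)"
    using l2_inner_grad[OF first] by (simp add: j sum_negf)
  finally show ?thesis .
qed

text \<open>The second mixed equation may be used with the second derivatives of \<open>\<phi>\<close> because these are
  test functions as well. This is the reason to argue with test functions first: for a general
  \<open>\<phi> \<in> H\<^sub>0\<^sup>2(\<Omega>)\<close> they need not have weak derivatives in \<open>L\<^sup>2\<close>.\<close>

lemma mixed_solution_primal_equation_test_fun:
  fixes \<Omega> :: "(real^'d) set"
  assumes "open \<Omega>" "mixed_solution \<Omega> \<epsilon> f \<psi> u" "u \<in> sobolev 2 \<Omega>" "test_fun \<Omega> \<phi>"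
  shows "\<epsilon>\<^sup>2 * l2_inner \<Omega> (laplacian \<Omega> u) (laplacian \<Omega> \<phi>) + l2_inner \<Omega> (grad \<Omega> u) (grad \<Omega> \<phi>)
    = l2_inner \<Omega> f \<phi>"
proof -
  note test = test_fun_partial[OF test_fun_partial[OF assms(4)]]
  have \<psi>: "\<psi> \<in> sobolev 1 \<Omega>"
    and mixed1: "\<epsilon>\<^sup>2 * l2_inner \<Omega> (grad \<Omega> \<psi>) (grad \<Omega> \<phi>) + l2_inner \<Omega> \<psi> \<phi> = l2_inner \<Omega> f \<phi>"
    and mixed2: "\<And>\<zeta>. test_fun \<Omega> \<zeta> \<Longrightarrow> l2_inner \<Omega> (grad \<Omega> u) (grad \<Omega> \<zeta>) = l2_inner \<Omega> \<psi> \<zeta>"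
    using assms(2) test_fun_sobolev0[OF assms(1,4)] test_fun_sobolev[OF assms(1)]
    unfolding mixed_solution_def by blast+
  have first: "weak_deriv \<Omega> [i] \<psi> \<in> L2 \<Omega>" "weak_deriv \<Omega> [i] \<phi> \<in> L2 \<Omega>" for i
    using \<psi> test_fun_sobolev[OF assms(1,4), of 1] by (auto intro: weak_deriv_L2)
  have i: "l2_inner \<Omega> (laplacian \<Omega> u) (weak_deriv \<Omega> [i, i] \<phi>)
      = l2_inner \<Omega> (weak_deriv \<Omega> [i] \<psi>) (weak_deriv \<Omega> [i] \<phi>)" for i
  proof -
    have "l2_inner \<Omega> (laplacian \<Omega> u) (weak_deriv \<Omega> [i, i] \<phi>)
        = l2_inner \<Omega> (laplacian \<Omega> u) (partial i (partial i \<phi>))"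
      using weak_deriv_test_fun[OF assms(1,4), of "[i, i]"] test_fun_in_L2[OF assms(1) test]
        laplacian_L2[OF assms(3)] weak_deriv_L2[OF test_fun_sobolev[OF assms(1,4)], of "[i, i]" 2]
      by (intro l2_inner_cong_AE) auto
    also have "\<dots> = - l2_inner \<Omega> \<psi> (partial i (partial i \<phi>))"
      by (simp add: l2_inner_laplacian_test_fun[OF assms(1,3) test] mixed2[OF test])
    also have "\<dots> = l2_inner \<Omega> (weak_deriv \<Omega> [i] \<psi>) (partial i \<phi>)"
    proof -
      have "has_weak_deriv \<Omega> [i] \<psi> (weak_deriv \<Omega> [i] \<psi>)"
        by (rule has_weak_deriv_weak_deriv[OF \<psi>]) simp
      then have "l2_inner \<Omega> \<psi> (partials [i] (partial i \<phi>))
          = (-1) ^ length [i] * l2_inner \<Omega> (weak_deriv \<Omega> [i] \<psi>) (partial i \<phi>)"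
        using test_fun_partial[OF assms(4)] unfolding has_weak_deriv_def by blast
      then show ?thesis by simp
    qed
    also have "\<dots> = l2_inner \<Omega> (weak_deriv \<Omega> [i] \<psi>) (weak_deriv \<Omega> [i] \<phi>)"
      using weak_deriv_test_fun[OF assms(1,4), of "[i]"] first
        test_fun_in_L2[OF assms(1) test_fun_partial[OF assms(4)]]
      by (intro l2_inner_cong_AE) (auto intro: ae_eq_sym)
    finally show ?thesis .
  qed
  have "l2_inner \<Omega> (laplacian \<Omega> u) (laplacian \<Omega> \<phi>) = l2_inner \<Omega> (grad \<Omega> \<psi>) (grad \<Omega> \<phi>)"
    using l2_inner_laplacian[OF test_fun_sobolev[OF assms(1,4)] laplacian_L2[OF assms(3)]]
      l2_inner_grad[OF first] by (simp add: i)
  then show ?thesis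
    using mixed1 mixed2[OF assms(4)] by simp
qed

text \<open>Both sides of the primal equation are finite sums of inner products of a fixed \<open>L\<^sup>2\<close>
  function with weak derivatives of order at most two, so they pass to the limit along test functions
  approximating \<open>v\<close>. The right-hand side is brought to this form with the weak derivative of order
  zero.\<close>

lemma primal_solution_if_test_funs:
  fixes \<Omega> :: "(real^'d) set"
  assumes "open \<Omega>" "f \<in> L2 \<Omega>" "u \<in> sobolev0 2 \<Omega>"
    and test: "\<And>\<phi>. test_fun \<Omega> \<phi> \<Longrightarrow>
      \<epsilon>\<^sup>2 * l2_inner \<Omega> (laplacian \<Omega> u) (laplacian \<Omega> \<phi>) + l2_inner \<Omega> (grad \<Omega> u) (grad \<Omega> \<phi>)
        = l2_inner \<Omega> f \<phi>"
  shows "primal_solution \<Omega> \<epsilon> f u"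
  unfolding primal_solution_def
proof (intro conjI ballI)
  fix v assume "v \<in> sobolev0 2 \<Omega>"
  then obtain \<phi> where v: "v \<in> sobolev 2 \<Omega>" and \<phi>: "\<And>n. test_fun \<Omega> (\<phi> n)"
    and lim: "(\<lambda>n. sobolev_norm 2 \<Omega> (\<lambda>x. \<phi> n x - v x)) \<longlonglongrightarrow> 0"
    unfolding sobolev0_def by blast
  note u = sobolev0_sobolev[OF assms(3)]
  let ?B = "\<lambda>v. \<epsilon>\<^sup>2 * (\<Sum>i\<in>UNIV. l2_inner \<Omega> (laplacian \<Omega> u) (weak_deriv \<Omega> [i, i] v))
    + (\<Sum>i\<in>UNIV. l2_inner \<Omega> (weak_deriv \<Omega> [i] u) (weak_deriv \<Omega> [i] v))"
  have B: "\<epsilon>\<^sup>2 * l2_inner \<Omega> (laplacian \<Omega> u) (laplacian \<Omega> w) + l2_inner \<Omega> (grad \<Omega> u) (grad \<Omega> w) = ?B w"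
    if "w \<in> sobolev 2 \<Omega>" for w
    using l2_inner_laplacian[OF that laplacian_L2[OF u]]
      l2_inner_grad[OF weak_deriv_L2[OF u] weak_deriv_L2[OF that]] by simp
  have F: "l2_inner \<Omega> f w = l2_inner \<Omega> f (weak_deriv \<Omega> [] w)" if "w \<in> L2 \<Omega>" for w
    using weak_deriv_ae_eq[OF assms(1) that has_weak_deriv_Nil]
      weak_deriv_L2_if[OF that has_weak_deriv_Nil] assms(2) that
    by (intro l2_inner_cong_AE) (auto intro: ae_eq_sym)
  note conv = l2_inner_weak_deriv_tendsto[OF assms(1) v test_fun_sobolev[OF assms(1) \<phi>] lim]
  have "(\<lambda>n. ?B (\<phi> n)) \<longlonglongrightarrow> ?B v"
    by (intro tendsto_intros conv laplacian_L2 weak_deriv_L2[OF u]) (use u in auto)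
  moreover have "?B (\<phi> n) = l2_inner \<Omega> f (weak_deriv \<Omega> [] (\<phi> n))" for n
    using B[OF test_fun_sobolev[OF assms(1) \<phi>[of n]]] test[OF \<phi>[of n]]
      F[OF test_fun_in_L2[OF assms(1) \<phi>[of n]]] by simp
  moreover have "(\<lambda>n. l2_inner \<Omega> f (weak_deriv \<Omega> [] (\<phi> n))) \<longlonglongrightarrow> l2_inner \<Omega> f (weak_deriv \<Omega> [] v)"
    by (intro conv assms(2)) simp
  ultimately have "?B v = l2_inner \<Omega> f (weak_deriv \<Omega> [] v)"
    using LIMSEQ_unique by simp
  then show "\<epsilon>\<^sup>2 * l2_inner \<Omega> (laplacian \<Omega> u) (laplacian \<Omega> v) + l2_inner \<Omega> (grad \<Omega> u) (grad \<Omega> v)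
      = l2_inner \<Omega> f v"
    using B[OF v] F[OF sobolev_L2[OF v]] by simp
qed (rule assms(3))

theorem theorem2p2:
  fixes \<Omega> :: "(real^'d) set"
    and f ut \<psi> u :: "real^'d \<Rightarrow> real"
    and \<epsilon> :: real
  assumes "CARD('d) \<in> {2, 3}"
    and "polyhedral_lipschitz_domain \<Omega>"
    and "f \<in> L2 \<Omega>"
    and "\<epsilon> > 0"
    and "primal_uniquely_solvable \<Omega> \<epsilon> f"
    and "mixed_uniquely_solvable \<Omega> \<epsilon> f"
    and "primal_solution \<Omega> \<epsilon> f ut"
    and "mixed_solution \<Omega> \<epsilon> f \<psi> u"
  shows "ae_eq \<Omega> ut u \<longleftrightarrow> u \<in> sobolev0 2 \<Omega>"
proof
  have "open \<Omega>"
    using assms(2) by (simp add: polyhedral_lipschitz_domain_def)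
  {
    assume "ae_eq \<Omega> ut u"
    moreover have "ut \<in> sobolev0 2 \<Omega>"
      using assms(7) by (simp add: primal_solution_def)
    moreover have "u \<in> sobolev0 1 \<Omega>"
      using assms(8) by (simp add: mixed_solution_def)
    then have "u \<in> L2 \<Omega>"
      by (intro sobolev_L2 sobolev0_sobolev)
    ultimately show "u \<in> sobolev0 2 \<Omega>"
      using sobolev0_cong[OF \<open>open \<Omega>\<close>] by blast
  }
  {
    assume u: "u \<in> sobolev0 2 \<Omega>"
    then have "u \<in> sobolev 2 \<Omega>"
      by (rule sobolev0_sobolev)
    then have "primal_solution \<Omega> \<epsilon> f u"
      by (intro primal_solution_if_test_funs[OF \<open>open \<Omega>\<close> assms(3) u]
          mixed_solution_primal_equation_test_fun[OF \<open>open \<Omega>\<close> assms(8)])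
    then show "ae_eq \<Omega> ut u"
      using assms(5,7) unfolding primal_uniquely_solvable_def by blast
  }
qed

end
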